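(* Let $S = \langle g_1, \ldots, g_k\rangle$ be a numerical semigroup and let $g = g_1 + \cdots + g_k$. Write $\operatorname{Ap}(S; g) = \{a_0, a_1, \ldots, a_{g-1}\}$ with $a_0 = 0$ and each $a_j \equiv j \bmod g$. Fix $n \in S$, and fix $i \in \{0, 1, \ldots, g-1\}$ so that $i \equiv -n \bmod g$. Then \[ \ell_\infty^m(n) = \tfrac{1}{g}(n + a_i) \] for all $n > g^2$. In particular, for all $n > g^2$, we have \[ \ell_\infty^m(n) = \ell_\infty^m(n - g) + 1. \]
   Context: A numerical semigroup $S$ is an additive submonoid of $\mathbb{Z}_{\ge 0}$ with finite complement. Writing $S = \langle g_1, \ldots, g_k\rangle = \{z_1 g_1 + \cdots + z_k g_k : z_1, \ldots, z_k \in \mathbb{Z}_{\ge 0}\}$ means that $g_1, \ldots, g_k$ are the (distinct) atoms (irreducible elements, i.e. minimal generators) of $S$. For $n \in S$, the set of factorizations of $n$ is $\mathsf{Z}(n) = \{\mathbf{z} \in \mathbb{Z}_{\ge 0}^k : n = z_1 g_1 + \cdots + z_k g_k\}$. For $\mathbf{z} \in \mathbb{Z}^k$, let $\ell_\infty(\mathbf{z}) = \max\{z_1, \ldots, z_k\}$, and for $n \in S$ let $\ell_\infty^m(n) = \min\{\ell_\infty(\mathbf{z}) : \mathbf{z} \in \mathsf{Z}(n)\}$ (here the superscript $m$ stands for "minimum" and is not an exponent). For a positive $s \in S$, the Apéry set of $S$ with respect to $s$ is $\operatorname{Ap}(S; s) = \{t \in S : t - s \notin S\}$. It consists of the smallest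 element of $S$ in each congruence class modulo $s$, so it has exactly one element in each class modulo $s$. *)

theory Defs
  imports Complex_Main "HOL-Library.FuncSet" "HOL-Number_Theory.Cong"
begin

definition numerical_semigroup :: "nat set \<Rightarrow> bool" where
  "numerical_semigroup S \<longleftrightarrow>
     0 \<in> S \<and> (\<forall>x\<in>S. \<forall>y\<in>S. x + y \<in> S) \<and> finite (UNIV - S)"

text \<open>Since \<open>0\<close> is the only unit of a submonoid of the naturals, an atom is a nonzero element
  that is not a sum of two nonzero elements.\<close>

definition atoms :: "nat set \<Rightarrow> nat set" where
  "atoms S = {a \<in> S. a \<noteq> 0 \<and> \<not> (\<exists>b\<in>S. \<exists>c\<in>S. b \<noteq> 0 \<and> c \<noteq> 0 \<and> a = b + c)}"

definition generated :: "nat \<Rightarrow> (nat \<Rightarrow> nat) \<Rightarrow> nat set" where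
  "generated k g = {n. \<exists>z :: nat \<Rightarrow> nat. n = (\<Sum>j=1..k. z j * g j)}"

text \<open>\<open>S = \<langle>g 1, \<dots>, g k\<rangle>\<close>, the \<open>g j\<close> being the pairwise distinct atoms of \<open>S\<close>.\<close>

definition num_semigroup_gens :: "nat set \<Rightarrow> nat \<Rightarrow> (nat \<Rightarrow> nat) \<Rightarrow> bool" where
  "num_semigroup_gens S k g \<longleftrightarrow>
     numerical_semigroup S \<and> S = generated k g \<and> inj_on g {1..k} \<and> g ` {1..k} = atoms S"

text \<open>A vector with \<open>k\<close> coordinates is a function that is extensional on \<open>{1..k}\<close>, so that
  distinct functions are distinct vectors.\<close>

definition factorizations :: "nat \<Rightarrow> (nat \<Rightarrow> nat) \<Rightarrow> nat \<Rightarrow> (nat \<Rightarrow> nat) set" where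
  "factorizations k g n = {z \<in> {1..k} \<rightarrow>\<^sub>E UNIV. n = (\<Sum>j=1..k. z j * g j)}"

text \<open>No absolute values are taken: this is the largest coordinate.\<close>

definition ell_inf :: "nat \<Rightarrow> (nat \<Rightarrow> 'a::linorder) \<Rightarrow> 'a" where
  "ell_inf k z = Max (z ` {1..k})"

definition ell_inf_min :: "nat \<Rightarrow> (nat \<Rightarrow> nat) \<Rightarrow> nat \<Rightarrow> nat" where
  "ell_inf_min k g n = Min (ell_inf k ` factorizations k g n)"

text \<open>The difference \<open>t - s\<close> is taken in the integers; the truncated one would be \<open>0 \<in> S\<close>
  whenever \<open>t < s\<close>.\<close>

definition Apery :: "nat set \<Rightarrow> nat \<Rightarrow> nat set" where
  "Apery S s = {t \<in> S. int t - int s \<notin> int ` S}"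

end

theory Submission
  imports Defs
begin

text \<open>Subtracting a factorization of \<open>n\<close> coordinatewise from the constant vector \<open>m\<close> leaves a
  factorization of \<open>m g - n\<close>, so \<open>\<ell>\<^sub>\<infinity>\<^sup>m(n)\<close> is the least \<open>m\<close> such that
  \<open>m g - n\<close> has a factorization with all coordinates at most \<open>m\<close>. The least element of \<open>S\<close>
  of the form \<open>m g - n\<close> is the Apery element in the class of \<open>-n\<close>. The coordinates of its
  factorizations are all smaller than \<open>g\<close>, because \<open>g - g\<^sub>i\<close> copies of \<open>g\<^sub>i\<close> can be traded
  for \<open>g\<^sub>i\<close> copies of every other generator, after which \<open>g\<close> can be subtracted. So the bound
  on the coordinates holds automatically once \<open>m \<ge> g\<close>.\<close>

lemma generated_diff_of_large_coordinate:
  fixes gen c :: "nat \<Rightarrow> nat"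
  assumes g: "g = (\<Sum>j=1..k. gen j)"
    and pos: "\<And>j. j \<in> {1..k} \<Longrightarrow> gen j > 0"
    and i: "i \<in> {1..k}" "c i \<ge> g"
  shows "\<exists>s \<in> generated k gen. (\<Sum>j=1..k. c j * gen j) = g + s"
proof -
  \<comment> \<open>Trading \<open>g\<close> copies of \<open>gen i\<close> for \<open>gen i\<close>
    copies of every generator keeps the value; the \<open>- 1\<close> then removes one copy of each,
    that is \<open>g\<close>. No subtraction truncates, since \<open>gen i > 0\<close> and
    \<open>c i \<ge> g\<close>.\<close>
  define d where "d j = c j + gen i - 1 - (if j = i then g else 0)" for j
  have "d j + 1 + (if j = i then g else 0) = c j + gen i" for j
    using i pos[OF i(1)] by (auto simp: d_def)
  then have "(\<Sum>j=1..k. (d j + 1 + (if j = i then g else 0)) * gen j)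
      = (\<Sum>j=1..k. (c j + gen i) * gen j)"
    by simp
  moreover have "(\<Sum>j=1..k. (if j = i then g else 0) * gen j) = g * gen i"
    using i by (simp add: if_distrib[of "\<lambda>x. x * _"] sum.delta cong: if_cong)
  moreover have "(\<Sum>j=1..k. gen i * gen j) = gen i * g"
    unfolding g by (simp add: sum_distrib_left)
  ultimately have "(\<Sum>j=1..k. c j * gen j) = g + (\<Sum>j=1..k. d j * gen j)"
    using g by (simp add: distrib_right sum.distrib)
  then show ?thesis
    by (auto simp: generated_def)
qed

lemma generated_add:
  assumes "s \<in> generated k gen" "t \<in> generated k gen"
  shows "s + t \<in> generated k gen"
proof -
  obtain y z where "s = (\<Sum>j=1..k. y j * gen j)" "t = (\<Sum>j=1..k. z j * gen j)"
    using assms by (auto simp: generated_def)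
  then have "s + t = (\<Sum>j=1..k. (y j + z j) * gen j)"
    by (simp add: distrib_right sum.distrib)
  then show ?thesis
    unfolding generated_def by (intro CollectI exI[of _ "\<lambda>j. y j + z j"])
qed

lemma generated_mult_sum: "m * (\<Sum>j=1..k. gen j) \<in> generated k gen"
  unfolding generated_def by (auto simp: sum_distrib_left intro!: exI[of _ "\<lambda>_. m"])

lemma Apery_iff: "t \<in> Apery S s \<longleftrightarrow> t \<in> S \<and> (\<nexists>u. u \<in> S \<and> t = s + u)"
proof -
  have "int t - int s = int u \<longleftrightarrow> t = s + u" for u
    by linarith
  then show ?thesis
    by (auto simp: Apery_def image_iff)
qed

text \<open>Positive generators bound every coordinate by \<open>n\<close>. Finiteness makes the
  \<open>Min\<close> in \<open>ell_inf_min\<close> meaningful.\<close>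

lemma finite_factorizations:
  assumes "\<And>j. j \<in> {1..k} \<Longrightarrow> gen j > 0"
  shows "finite (factorizations k gen n)"
proof (rule finite_subset)
  show "factorizations k gen n \<subseteq> {1..k} \<rightarrow>\<^sub>E {..n}"
  proof
    fix z assume z: "z \<in> factorizations k gen n"
    have "z j \<le> n" if "j \<in> {1..k}" for j
    proof -
      have "z j \<le> z j * gen j"
        using assms[OF that] by simp
      also have "\<dots> \<le> (\<Sum>j=1..k. z j * gen j)"
        using that by (intro member_le_sum) auto
      finally show ?thesis
        using z by (simp add: factorizations_def)
    qed
    then show "z \<in> {1..k} \<rightarrow>\<^sub>E {..n}"
      using z by (auto simp: factorizations_def PiE_iff)
  qed
qed (simp add: finite_PiE)

text \<open>The bound on the coordinates makes the truncated differences exact. Complementing serves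
  both for the lower bound on the maximum and for building an optimal factorization.\<close>

lemma sum_complement_factorization:
  fixes gen z :: "nat \<Rightarrow> nat"
  assumes "\<And>j. j \<in> {1..k} \<Longrightarrow> z j \<le> m"
  shows "(\<Sum>j=1..k. z j * gen j) + (\<Sum>j=1..k. (m - z j) * gen j) = m * (\<Sum>j=1..k. gen j)"
proof -
  have "(\<Sum>j=1..k. z j * gen j + (m - z j) * gen j) = (\<Sum>j=1..k. m * gen j)"
    using assms by (intro sum.cong) (auto simp flip: distrib_right)
  then show ?thesis
    by (simp add: sum.distrib sum_distrib_left)
qed

text \<open>Assuming \<open>m \<ge> g\<close> instead of \<open>n > g ^ 2\<close> lets the lemma
  apply to \<open>n - g\<close> as well as to \<open>n\<close>.\<close>

lemma ell_inf_min_eq: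
  fixes gen :: "nat \<Rightarrow> nat"
  assumes g: "g = (\<Sum>j=1..k. gen j)"
    and pos: "\<And>j. j \<in> {1..k} \<Longrightarrow> gen j > 0"
    and k: "k \<ge> 1"
    and t: "t \<in> Apery (generated k gen) g"
    and m: "n + t = m * g" "m \<ge> g"
  shows "ell_inf_min k gen n = m"
proof -
  have lower: "m \<le> ell_inf k z" if z: "z \<in> factorizations k gen n" for z
  proof (rule ccontr)
    assume "\<not> m \<le> ell_inf k z"
    then obtain r where r: "m = Suc (ell_inf k z + r)"
      by (metis not_le less_imp_Suc_add)
    define s where "s = (\<Sum>j=1..k. (ell_inf k z - z j) * gen j)"
    have "z j \<le> ell_inf k z" if "j \<in> {1..k}" for j
      using that by (simp add: ell_inf_def)
    then have "n + s = ell_inf k z * g"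
      using sum_complement_factorization[of k z "ell_inf k z" gen] z
      by (simp add: factorizations_def s_def g)
    \<comment> \<open>A maximum below \<open>m\<close> puts \<open>t\<close> at least one whole
      \<open>g\<close> above the element \<open>s\<close>, so \<open>t\<close> cannot be in the
      Apery set.\<close>
    then have "t = g + (s + r * g)"
      using m(1) by (simp add: r algebra_simps)
    moreover have "s + r * g \<in> generated k gen"
      unfolding g by (intro generated_add generated_mult_sum) (auto simp: s_def generated_def)
    ultimately show False
      using t by (auto simp: Apery_iff)
  qed
  obtain c where c: "t = (\<Sum>j=1..k. c j * gen j)"
    using t by (auto simp: Apery_iff generated_def)
  \<comment> \<open>A coordinate above \<open>m\<close> would be at least \<open>g\<close>, and the
    trade would leave \<open>t - g\<close> in the semigroup.\<close>
  have c_le: "c j \<le> m" if "j \<in> {1..k}" for j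
  proof (rule ccontr)
    assume "\<not> c j \<le> m"
    then show False
      using generated_diff_of_large_coordinate[OF g pos that, of c] t m(2)
      by (auto simp: Apery_iff c)
  qed
  define z where "z = (\<lambda>j\<in>{1..k}. m - c j)"
  have "n = (\<Sum>j=1..k. (m - c j) * gen j)"
    using sum_complement_factorization[of k c m gen, OF c_le] m(1) by (simp add: c g)
  then have z: "z \<in> factorizations k gen n"
    by (simp add: factorizations_def z_def)
  \<comment> \<open>Here \<open>k \<ge> 1\<close> ensures that the maximum is over a nonempty
    set.\<close>
  have "ell_inf k z \<le> m"
    using k by (auto simp: ell_inf_def z_def)
  with lower[OF z] have "ell_inf k z = m"
    by simp
  then show ?thesis
    unfolding ell_inf_min_def using z lower finite_factorizations[OF pos]
    by (intro Min_eqI) auto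
qed

theorem theorem2p6:
  fixes S :: "nat set" and k :: nat and gen :: "nat \<Rightarrow> nat" and g :: nat
    and a :: "nat \<Rightarrow> nat"
  assumes "num_semigroup_gens S k gen"
    and "g = (\<Sum>j=1..k. gen j)"
    and "Apery S g = a ` {0..<g}"
    and "a 0 = 0"
    and "\<And>j. j < g \<Longrightarrow> [a j = j] (mod g)"
  shows "(\<forall>n\<in>S. \<forall>i\<in>{0..<g}. [int i = - int n] (mod int g) \<longrightarrow> n > g ^ 2 \<longrightarrow>
            real (ell_inf_min k gen n) = (1 / real g) * (real n + real (a i))) \<and>
         (\<forall>n\<in>S. n > g ^ 2 \<longrightarrow>
            n - g \<in> S \<and> ell_inf_min k gen n = ell_inf_min k gen (n - g) + 1)"
proof -
  have S: "S = generated k gen"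
    using assms(1) by (simp add: num_semigroup_gens_def)
  have pos: "gen j > 0" if "j \<in> {1..k}" for j
  proof -
    have "gen j \<in> atoms S"
      using assms(1) that by (metis num_semigroup_gens_def imageI)
    then show ?thesis
      by (simp add: atoms_def)
  qed
  have k: "k \<ge> 1"
  proof (rule ccontr)
    assume "\<not> k \<ge> 1"
    then have "S = {0}"
      by (auto simp: S generated_def)
    then have "finite (UNIV :: nat set)"
      using assms(1) by (simp add: num_semigroup_gens_def numerical_semigroup_def)
    then show False
      by simp
  qed
  have "gen 1 \<le> g"
    unfolding assms(2) using k by (intro member_le_sum) auto
  then have "g > 0"
    using pos[of 1] k by simp
  \<comment> \<open>The strict \<open>m > g\<close> leaves room for \<open>m - 1 \<ge> g\<close>,
    which the recurrence needs.\<close>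
  have multiple: "\<exists>m. n + a i = m * g \<and> m > g"
    if "i < g" "[int i = - int n] (mod int g)" "n > g ^ 2" for n i
  proof -
    have "[int (a i) = int i] (mod int g)"
      using assms(5)[OF that(1)] by (simp add: cong_int_iff)
    then have "[int (a i) = - int n] (mod int g)"
      using that(2) cong_trans by blast
    then have "int g dvd int (n + a i)"
      by (simp add: cong_iff_dvd_diff add.commute)
    then obtain m where m: "n + a i = m * g"
      by (metis dvdE mult.commute int_dvd_int_iff)
    then have "g * g < m * g"
      using that(3) unfolding power2_eq_square by linarith
    then show ?thesis
      using m by auto
  qed
  have ell: "ell_inf_min k gen n = m" if "i < g" "n + a i = m * g" "m \<ge> g" for n m i
    using that assms(3) S by (intro ell_inf_min_eq[OF assms(2) pos k]) auto
  show ?thesis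
  proof (intro conjI ballI impI)
    fix n i
    assume i: "i \<in> {0..<g}" "[int i = - int n] (mod int g)" "n > g ^ 2"
    then obtain m where m: "n + a i = m * g" "m > g"
      using multiple by auto
    then have "ell_inf_min k gen n = m"
      using ell i(1) by simp
    moreover have "real n + real (a i) = real m * real g"
      using m(1) by (metis of_nat_add of_nat_mult)
    ultimately show "real (ell_inf_min k gen n) = (1 / real g) * (real n + real (a i))"
      using \<open>g > 0\<close> by simp
  next
    fix n
    assume n: "n \<in> S" "n > g ^ 2"
    obtain z where z: "n = (\<Sum>j=1..k. z j * gen j)"
      using n(1) by (auto simp: S generated_def)
    \<comment> \<open>Coordinates all at most \<open>g\<close> would give
      \<open>n \<le> g * g\<close>. A large one allows the trade, which splits off \<open>g\<close>
      from \<open>n\<close>.\<close>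
    have "\<exists>j\<in>{1..k}. z j \<ge> g"
    proof (rule ccontr)
      assume "\<not> ?thesis"
      then have "z j \<le> g" if "j \<in> {1..k}" for j
        using that by (meson linear)
      then have "n \<le> (\<Sum>j=1..k. g * gen j)"
        unfolding z by (intro sum_mono mult_right_mono) auto
      then show False
        using n(2) by (simp add: power2_eq_square assms(2) flip: sum_distrib_left)
    qed
    then obtain s where "s \<in> S" "n = g + s"
      using generated_diff_of_large_coordinate[OF assms(2) pos] S z by blast
    then show "n - g \<in> S"
      by simp
    define i where "i = nat (- int n mod int g)"
    have i: "i < g" "[int i = - int n] (mod int g)"
      using \<open>g > 0\<close> by (auto simp: i_def nat_less_iff cong_def)
    then obtain m where m: "n + a i = m * g" "m > g"
      using multiple n(2) by blast
    \<comment> \<open>Since \<open>n\<close> and \<open>n - g\<close> are congruent modulo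
      \<open>g\<close>, the same Apery element \<open>a i\<close> serves both, and only the
      multiplier drops by one.\<close>
    then have "n - g + a i = (m - 1) * g"
      using \<open>n = g + s\<close> by (simp add: diff_mult_distrib)
    then show "ell_inf_min k gen n = ell_inf_min k gen (n - g) + 1"
      using ell[OF i(1) m(1)] ell[OF i(1), of "n - g" "m - 1"] m(2) by simp
  qed
qed

end
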